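(* Let $m$ be a positive integer. Let $\overrightarrow{K}_3$ be the oriented $3$-cycle on vertices $a,b,c$ with Hermitian matrix (rows/columns ordered $a,b,c$) $$H_X=\begin{bmatrix}0&-i&i\\ i&0&-i\\ -i&i&0\end{bmatrix},$$ and let $Y=\overrightarrow{K}_3\circ K_{1,m}$ be the rooted product obtained by attaching to each of $a,b,c$ $m$ new pendant vertices, each joined to it by an edge of weight $1$; that is, $Y$ has Hermitian matrix whose restriction to $\{a,b,c\}$ is $H_X$, with entry $1$ between each of $a,b,c$ and each of its $m$ pendant neighbours, and all other entries $0$. Then $Y$ admits multiple pretty good state transfer on the set $\{a,b,c\}$ if and only if one of the following holds: (1) $\gcd(3,m)=1$; (2) $m=3s$ for some integer $s$ such that neither $s$ nor $4s+1$ is a perfect square; (3) $m=27k^2$ for some integer $k$; (4) $m=27k^2+27k+6$ for some integer $k$.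
   Context: For a Hermitian graph with Hermitian matrix $H$, the transition matrix is $U(t)=e^{-itH}$. There is pretty good state transfer from vertex $u$ to vertex $v$ if for every $\varepsilon>0$ there is a time $\tau$ with $|U(\tau)_{u,v}|\ge 1-\varepsilon$. A graph has multiple pretty good state transfer on a set $S$ of vertices if there is pretty good state transfer between any two distinct vertices of $S$ (in both directions). *)

theory Defs
  imports
    Complex_Main
    "HOL-Computational_Algebra.Nth_Powers"
    "Jordan_Normal_Form.Jordan_Normal_Form"
begin

text \<open>
  A Hermitian graph on the vertices \<open>0, \<dots>, n - 1\<close> is given by its Hermitian matrix, a complex
  \<open>n \<times> n\<close> matrix equal to its conjugate transpose.
\<close>

definition hermitian_mat :: "nat \<Rightarrow> complex mat \<Rightarrow> bool" where
  "hermitian_mat n H \<longleftrightarrow> H \<in> carrier_mat n n \<and> (\<forall>u<n. \<forall>v<n. H $$ (u, v) = cnj (H $$ (v, u)))"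


text \<open>
  The entrywise series defining the exponential of a square matrix. It always converges, see
  \<open>summable_mat_exp\<close> below, so \<^const>\<open>suminf\<close> is the actual sum.
\<close>

definition mat_exp :: "complex mat \<Rightarrow> complex mat" where
  "mat_exp A = mat (dim_row A) (dim_col A) (\<lambda>(i, j). \<Sum>k. (A ^\<^sub>m k) $$ (i, j) / fact k)"

lemma summable_mat_exp:
  assumes A: "A \<in> carrier_mat n n" and i: "i < n" and j: "j < n"
  shows "summable (\<lambda>k. (A ^\<^sub>m k) $$ (i, j) / (fact k :: complex))"
proof -
  obtain b where b: "norm_bound A b"
    using norm_bound_max by blast
  have Ak: "A ^\<^sub>m k \<in> carrier_mat n n" for k
    using A by simp
  have bound: "norm_bound (A ^\<^sub>m k) ((b * n) ^ k)" for k
  proof (induction k)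
    case 0
    show ?case using A by (auto simp: norm_bound_def)
  next
    case (Suc k)
    have "norm_bound (A ^\<^sub>m k * A) ((b * n) ^ k * b * of_nat n)"
      by (rule norm_bound_mult[OF Ak A Suc b])
    then show ?case by (simp add: ac_simps)
  qed
  show ?thesis
  proof (rule summable_comparison_test)
    show "summable (\<lambda>k. (b * n) ^ k /\<^sub>R fact k)"
      by (rule summable_exp_generic)
    have "norm ((A ^\<^sub>m k) $$ (i, j)) \<le> (b * n) ^ k" for k
      using bound[of k] Ak[of k] i j unfolding norm_bound_def by (metis carrier_matD)
    then show "\<exists>N. \<forall>k\<ge>N. norm ((A ^\<^sub>m k) $$ (i, j) / (fact k :: complex)) \<le> (b * n) ^ k /\<^sub>R fact k"
      by (simp add: norm_mult norm_inverse divide_inverse mult.commute mult_left_mono)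
  qed
qed

definition transition :: "complex mat \<Rightarrow> real \<Rightarrow> complex mat" where
  "transition H t = mat_exp ((- \<i> * complex_of_real t) \<cdot>\<^sub>m H)"

definition pgst :: "complex mat \<Rightarrow> nat \<Rightarrow> nat \<Rightarrow> bool" where
  "pgst H u v \<longleftrightarrow> (\<forall>\<epsilon>>0. \<exists>\<tau>::real. cmod (transition H \<tau> $$ (u, v)) \<ge> 1 - \<epsilon>)"

definition multiple_pgst :: "complex mat \<Rightarrow> nat set \<Rightarrow> bool" where
  "multiple_pgst H S \<longleftrightarrow> (\<forall>u\<in>S. \<forall>v\<in>S. u \<noteq> v \<longrightarrow> pgst H u v)"


definition oriented_K3 :: "complex mat" where
  "oriented_K3 = mat_of_rows_list 3
     [[0, - \<i>, \<i>],
      [\<i>, 0, - \<i>],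
      [- \<i>, \<i>, 0]]"

text \<open>The star \<open>K\<^sub>1\<^sub>,\<^sub>m\<close>; its centre is the vertex \<open>0\<close>.\<close>

definition star :: "nat \<Rightarrow> complex mat" where
  "star m = mat (Suc m) (Suc m) (\<lambda>(i, j). if (i = 0) \<noteq> (j = 0) then 1 else 0)"

text \<open>
  The rooted product of \<open>X\<close> with \<open>Z\<close>, whose root is the vertex \<open>0\<close>: each vertex \<open>x\<close> of \<open>X\<close> is
  identified with the root of its own copy of \<open>Z\<close>. Vertex \<open>j\<close> of the copy of \<open>Z\<close> at \<open>x\<close> has index
  \<open>j * n + x\<close>, where \<open>n\<close> is the number of vertices of \<open>X\<close>. As the root is \<open>j = 0\<close>, the vertices
  of \<open>X\<close> keep their indices.
\<close>

definition rooted_product :: "complex mat \<Rightarrow> complex mat \<Rightarrow> complex mat" where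
  "rooted_product X Z =
     (let n = dim_row X; N = n * dim_row Z in
      mat N N (\<lambda>(p, q).
        (if p < n \<and> q < n then X $$ (p, q) else 0) +
        (if p mod n = q mod n then Z $$ (p div n, q div n) else 0)))"

text \<open>The vertices \<open>a, b, c\<close> of the oriented triangle are \<open>0, 1, 2\<close>.\<close>

abbreviation K3_star :: "nat \<Rightarrow> complex mat" where
  "K3_star m \<equiv> rooted_product oriented_K3 (star m)"

lemma K3_star_carrier: "K3_star m \<in> carrier_mat (3 * Suc m) (3 * Suc m)"
proof -
  have "dim_row oriented_K3 = 3" "dim_row (star m) = Suc m"
    by (simp_all add: oriented_K3_def star_def mat_of_rows_list_def)
  then show ?thesis
    unfolding rooted_product_def Let_def by (simp only: mat_carrier)
qed

lemma K3_star_index: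
  assumes "p < 3 * Suc m" and "q < 3 * Suc m"
  shows "K3_star m $$ (p, q) =
    (if p < 3 \<and> q < 3 then oriented_K3 $$ (p, q)
     else if (p < 3) \<noteq> (q < 3) \<and> p mod 3 = q mod 3 then 1 else 0)"
proof -
  have dims: "dim_row oriented_K3 = 3" "dim_row (star m) = Suc m"
    by (simp_all add: oriented_K3_def star_def mat_of_rows_list_def)
  have K: "K3_star m $$ (p, q) =
      (if p < 3 \<and> q < 3 then oriented_K3 $$ (p, q) else 0) +
      (if p mod 3 = q mod 3 then star m $$ (p div 3, q div 3) else 0)"
    using assms unfolding rooted_product_def Let_def dims by (simp only: index_mat prod.case)
  have "p div 3 < Suc m" "q div 3 < Suc m"
    using assms by (simp_all add: less_mult_imp_div_less mult.commute)
  then have S: "star m $$ (p div 3, q div 3) = (if (p < 3) \<noteq> (q < 3) then 1 else 0)"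
    unfolding star_def by (subst index_mat) (simp_all only: prod.case div_eq_0_iff, simp_all)
  show ?thesis
    unfolding K S by simp
qed

lemma hermitian_K3_star: "hermitian_mat (3 * Suc m) (K3_star m)"
proof -
  have X: "oriented_K3 $$ (p, q) = cnj (oriented_K3 $$ (q, p))" if "p < 3" "q < 3" for p q
  proof -
    have entry: "oriented_K3 $$ (x, y) = [[0, - \<i>, \<i>], [\<i>, 0, - \<i>], [- \<i>, \<i>, 0]] ! x ! y"
      if "x < 3" "y < 3" for x y
      using that by (simp add: oriented_K3_def mat_of_rows_list_def)
    have "p = 0 \<or> p = 1 \<or> p = 2" "q = 0 \<or> q = 1 \<or> q = 2"
      using that by linarith+
    then show ?thesis
      unfolding entry[OF that] entry[OF that(2,1)] by (elim disjE) simp_all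
  qed
  have "K3_star m $$ (p, q) = cnj (K3_star m $$ (q, p))"
    if "p < 3 * Suc m" "q < 3 * Suc m" for p q
  proof (cases "p < 3 \<and> q < 3")
    case True
    then show ?thesis
      using X[of p q] K3_star_index[OF that] K3_star_index[OF that(2,1)] by presburger
  next
    case False
    then show ?thesis
      unfolding K3_star_index[OF that] K3_star_index[OF that(2,1)] by auto
  qed
  then show ?thesis
    unfolding hermitian_mat_def using K3_star_carrier by blast
qed

end

theory Submission
  imports Defs "HOL-Analysis.Kronecker_Approximation_Theorem"
begin

text \<open>
  The Fourier vectors of \<open>\<int>/3\<close> diagonalise the triangle, with eigenvalues \<open>l = 0, \<surd>3, -\<surd>3\<close>. On each
  of them the rooted product acts through the roots \<open>(l \<plusminus> \<surd>(l\<^sup>2 + 4m)) / 2\<close> of \<open>x\<^sup>2 = l x + m\<close>.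
  With \<open>D = \<surd>(4m + 3)\<close>, \<open>\<kappa> = \<surd>3 / D < 1\<close> and \<open>\<phi> = 2\<pi>(u - v) / 3\<close> this gives
  \<open>3 U(t)\<^sub>u\<^sub>v = cos (\<surd>m t) + 2 (cos (\<phi> - \<surd>3t/2) cos (Dt/2) + \<kappa> sin (\<phi> - \<surd>3t/2) sin (Dt/2))\<close>.
  The right-hand side is close to \<open>3\<close> in absolute value only if \<open>sin (\<surd>m t)\<close>, \<open>sin (Dt/2)\<close> and
  \<open>sin (\<phi> - \<surd>3t/2)\<close> are all small. If \<open>\<surd>m = n\<surd>3\<close> or \<open>D = n\<surd>3\<close>, this is possible only for
  \<open>3 dvd n\<close>. In all other cases with \<open>m > 0\<close>, the numbers \<open>\<surd>m, D, \<surd>3\<close> are linearly independent over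
  the rationals, and Kronecker's theorem provides suitable times; if \<open>3 dvd n\<close>, it is enough to
  apply it to the two numbers that remain independent.
\<close>

section \<open>The transition matrix\<close>

text \<open>Splits the vertices as they are indexed: the three roots, then \<open>m\<close> layers
  holding one leaf of each root.\<close>

lemma sum_lessThan_3_mult_Suc:
  fixes f :: "nat \<Rightarrow> 'a :: comm_monoid_add"
  shows "(\<Sum>q<3 * Suc m. f q) =
    f 0 + f 1 + f 2 + (\<Sum>i<m. f (3 * Suc i) + f (3 * Suc i + 1) + f (3 * Suc i + 2))"
proof (induction m)
  case 0
  then show ?case by (simp add: numeral_3_eq_3 eval_nat_numeral)
next
  case (Suc m)
  have "(\<Sum>q<3 * Suc (Suc m). f q) = (\<Sum>q<3 * Suc m. f q) + (f (3 * Suc m) + f (3 * Suc m + 1) + f (3 * Suc m + 2))"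
    by (simp add: eval_nat_numeral add.assoc)
  then show ?case using Suc by (simp add: add.assoc)
qed

lemma oriented_K3_entry:
  "oriented_K3 $$ (0, 0) = 0" "oriented_K3 $$ (0, 1) = - \<i>" "oriented_K3 $$ (0, 2) = \<i>"
  "oriented_K3 $$ (1, 0) = \<i>" "oriented_K3 $$ (1, 1) = 0" "oriented_K3 $$ (1, 2) = - \<i>"
  "oriented_K3 $$ (2, 0) = - \<i>" "oriented_K3 $$ (2, 1) = \<i>" "oriented_K3 $$ (2, 2) = 0"
  by (simp_all add: oriented_K3_def mat_of_rows_list_def)

text \<open>
  \<open>(x\<^sup>k - y\<^sup>k) / (x - y)\<close> for the roots \<open>x, y\<close> of \<open>z\<^sup>2 = l z + m\<close>: the walks of length \<open>k\<close> from the
  root to a fixed leaf of a star with \<open>m\<close> leaves whose root carries a loop of weight \<open>l\<close>.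
\<close>

definition walk_coeff :: "nat \<Rightarrow> real \<Rightarrow> nat \<Rightarrow> real" where
  "walk_coeff m l k = (let D = sqrt (l\<^sup>2 + 4 * real m) in (((l + D) / 2) ^ k - ((l - D) / 2) ^ k) / D)"

lemma walk_coeff_rec:
  "walk_coeff m l (Suc (Suc k)) = l * walk_coeff m l (Suc k) + m * walk_coeff m l k"
proof -
  define D where "D = sqrt (l\<^sup>2 + 4 * real m)"
  have D2: "D * D = l * l + 4 * m"
    unfolding D_def by (simp add: power2_eq_square)
  have root: "x ^ Suc (Suc k) = l * x ^ Suc k + m * x ^ k" if "x * x = l * x + m" for x :: real
  proof -
    have "x ^ Suc (Suc k) = (x * x) * x ^ k" by simp
    then show ?thesis unfolding that by (simp add: algebra_simps)
  qed
  have r: "((l + D) / 2) * ((l + D) / 2) = l * ((l + D) / 2) + m"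
    "((l - D) / 2) * ((l - D) / 2) = l * ((l - D) / 2) + m"
    using D2 by (simp_all add: field_simps)
  show ?thesis
    unfolding walk_coeff_def Let_def D_def[symmetric] root[OF r(1)] root[OF r(2)]
    by (simp add: diff_divide_distrib add_divide_distrib algebra_simps)
qed

lemma walk_coeff_0: "walk_coeff m l 0 = 0"
  by (simp add: walk_coeff_def)

lemma walk_coeff_1: "m > 0 \<Longrightarrow> walk_coeff m l (Suc 0) = 1"
proof -
  assume "m > 0"
  then have "sqrt (l\<^sup>2 + 4 * real m) > 0" by (simp add: add_nonneg_pos)
  then show ?thesis by (simp add: walk_coeff_def Let_def field_simps)
qed

section \<open>Characters of Z/3 and the spectrum of the oriented triangle\<close>

definition \<omega> :: complex where "\<omega> = cis (2 * pi / 3)"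

lemma \<omega>_altdef: "\<omega> = Complex (- 1 / 2) (sqrt 3 / 2)"
proof -
  have angle: "2 * pi / 3 = pi - pi / 3"
    by simp
  have "cos (2 * pi / 3) = - 1 / 2" "sin (2 * pi / 3) = sqrt 3 / 2"
    unfolding angle cos_pi_minus sin_pi_minus by (simp_all add: cos_60 sin_60)
  then show ?thesis
    by (simp add: \<omega>_def complex_eq_iff)
qed

lemma \<omega>_cube: "\<omega> ^ 3 = 1"
  unfolding \<omega>_def Complex.DeMoivre by simp

lemma \<omega>_square: "\<omega>\<^sup>2 = - 1 - \<omega>"
  by (simp add: \<omega>_altdef complex_eq_iff power2_eq_square)

text \<open>The reduced form of \<open>\<omega> ^ 4 = \<omega>\<close> once
  \<open>\<omega>\<^sup>2\<close> has been replaced by \<open>- 1 - \<omega>\<close>.\<close>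

lemma minus_1_minus_\<omega>_square: "(- 1 - \<omega>)\<^sup>2 = \<omega>"
  using \<omega>_cube by (simp add: eval_nat_numeral flip: \<omega>_square)

definition K3_eig :: "nat \<Rightarrow> real" where
  "K3_eig j = (if j = 0 then 0 else if j = 1 then sqrt 3 else - sqrt 3)"

lemma K3_eig:
  assumes "j < 3"
  shows "complex_of_real (K3_eig j) = - \<i> * (\<omega> ^ j - (\<omega> ^ j)\<^sup>2)"
proof -
  consider "j = 0" | "j = 1" | "j = 2" using assms by linarith
  then show ?thesis
    by cases (simp_all add: K3_eig_def minus_1_minus_\<omega>_square \<omega>_square,
      simp_all add: \<omega>_altdef complex_eq_iff)
qed

lemma \<omega>_power_mod_3: "\<omega> ^ n = \<omega> ^ (n mod 3)"
proof -
  have "\<omega> ^ n = (\<omega> ^ 3) ^ (n div 3) * \<omega> ^ (n mod 3)"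
    by (metis mult_div_mod_eq power_add power_mult)
  then show ?thesis by (simp add: \<omega>_cube)
qed

text \<open>Orthogonality of the characters of Z/3; it yields the identity matrix as the zeroth
  power of \<open>K3_star m\<close>.\<close>

lemma sum_\<omega>_powers: "(\<Sum>j<3. (\<omega> ^ j) ^ n) = (if 3 dvd n then 3 else 0)"
proof -
  have "(\<Sum>j<3. (\<omega> ^ j) ^ n) = 1 + \<omega> ^ n + (\<omega> ^ n)\<^sup>2"
    by (simp add: numeral_3_eq_3 flip: power_mult) (simp add: mult.commute numeral_2_eq_2)
  also have "\<dots> = 1 + \<omega> ^ (n mod 3) + (\<omega> ^ (n mod 3))\<^sup>2"
    by (subst (1 2) \<omega>_power_mod_3) simp
  also have "\<dots> = (if 3 dvd n then 3 else 0)"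
  proof -
    consider "n mod 3 = 0" | "n mod 3 = 1" | "n mod 3 = 2" by linarith
    then show ?thesis
      by cases (auto simp: minus_1_minus_\<omega>_square \<omega>_square dvd_eq_mod_eq_0)
  qed
  finally show ?thesis .
qed

text \<open>The triangle is circulant, so \<open>q \<mapsto> w ^ (2 * q)\<close>, that is
  \<open>w\<close> to the power \<open>- q\<close>, is a left eigenvector for each cube root of
  unity \<open>w\<close>. The common factor \<open>w ^ u\<close> and the unevaluated exponents match
  the sum arising in \<open>K3_star_pow_entry\<close>.\<close>

lemma oriented_K3_left_eigenvector:
  assumes "j < 3" "q < 3"
  shows "(\<omega> ^ j) ^ (u + 2 * 0) * oriented_K3 $$ (0, q) + (\<omega> ^ j) ^ (u + 2 * 1) * oriented_K3 $$ (1, q)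
      + (\<omega> ^ j) ^ (u + 2 * 2) * oriented_K3 $$ (2, q) = K3_eig j * (\<omega> ^ j) ^ (u + 2 * q)"
proof -
  define w where "w = \<omega> ^ j"
  have "w ^ 3 = (\<omega> ^ 3) ^ j"
    by (simp add: w_def mult.commute flip: power_mult)
  then have w3: "w * (w * w) = 1"
    unfolding \<omega>_cube by (simp add: power3_eq_cube mult.assoc)
  \<comment> \<open>The cube relation in right-nested form with a tail, so that it applies inside
    longer products.\<close>
  have w3': "w * (w * (w * z)) = z" for z
  proof -
    have "w * (w * (w * z)) = w * (w * w) * z" by (simp only: mult.assoc)
    then show ?thesis by (simp add: w3)
  qed
  have "q = 0 \<or> q = 1 \<or> q = 2"
    using assms by linarith
  then show ?thesis
    unfolding K3_eig[OF assms(1)] w_def[symmetric]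
    by (elim disjE; simp add: oriented_K3_entry oriented_K3_entry(2,4,5,6,8)[simplified])
      (simp_all add: eval_nat_numeral algebra_simps w3 w3' power_add)
qed

text \<open>Row \<open>u\<close> is expanded in Fourier vectors. In each component one more step
  multiplies the root value by the eigenvalue, adds the \<open>m\<close> equal leaf values, and
  copies the old root value to the leaves. This is \<open>walk_coeff_rec\<close>, with the leaves
  one index behind the roots.\<close>

lemma K3_star_pow_entry:
  assumes m: "m > 0" and u: "u < 3" and q: "q < 3 * Suc m"
  shows "(K3_star m ^\<^sub>m k) $$ (u, q) =
    (\<Sum>j<3. (\<omega> ^ j) ^ (u + 2 * (q mod 3)) / 3 *
      walk_coeff m (K3_eig j) (if q < 3 then Suc k else k))"
  using q
proof (induction k arbitrary: q)
  case 0
  have dvd: "3 dvd u + 2 * q \<longleftrightarrow> u = q" if "q < 3"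
    using that u by presburger
  have "(K3_star m ^\<^sub>m 0) $$ (u, q) = (if u = q then 1 else 0)"
    using 0 u K3_star_carrier[of m] by simp
  then show ?case
    using u m by (auto simp: walk_coeff_0 walk_coeff_1 dvd sum_\<omega>_powers simp flip: sum_divide_distrib)
next
  case (Suc k)
  let ?H = "K3_star m"
  let ?W = "\<lambda>j. walk_coeff m (K3_eig j)"
  let ?T = "\<lambda>j q. (\<omega> ^ j) ^ (u + 2 * q) / 3"
  have carr: "?H ^\<^sub>m k \<in> carrier_mat (3 * Suc m) (3 * Suc m)"
    using K3_star_carrier by simp
  have "(?H ^\<^sub>m Suc k) $$ (u, q) = (\<Sum>r<3 * Suc m. (?H ^\<^sub>m k) $$ (u, r) * ?H $$ (r, q))"
    using carr K3_star_carrier[of m] Suc.prems u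
    by (simp add: scalar_prod_def atLeast0LessThan)
  also have "\<dots> = (\<Sum>r<3 * Suc m. (\<Sum>j<3. ?T j (r mod 3) * ?W j (if r < 3 then Suc k else k)) * ?H $$ (r, q))"
    by (intro sum.cong refl arg_cong2[where f = "(*)"] Suc.IH) simp
  also have "\<dots> = (\<Sum>j<3. ?T j (q mod 3) * ?W j (if q < 3 then Suc (Suc k) else Suc k))"
  proof (cases "q < 3")
    case True
    define S where "S = (\<Sum>j<3. ?T j q * ?W j k)"
    have far: "(\<Sum>j<3. ?T j (r mod 3) * ?W j (if r < 3 then Suc k else k)) * ?H $$ (r, q) =
        (if r mod 3 = q then S else 0)" if "r < 3 * Suc m" "r \<ge> 3" for r
      using that True Suc.prems K3_star_index[OF that(1) Suc.prems] by (auto simp: S_def)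
    \<comment> \<open>Exactly one of the three leaves in a layer is attached to
      \<open>q\<close>.\<close>
    have "f (3 * Suc i) + f (3 * Suc i + 1) + f (3 * Suc i + 2) = S"
      if "i < m" "f = (\<lambda>r. (\<Sum>j<3. ?T j (r mod 3) * ?W j (if r < 3 then Suc k else k)) * ?H $$ (r, q))" for i f
    proof -
      have "q = 0 \<or> q = 1 \<or> q = 2" using True by linarith
      moreover have "3 * Suc i mod 3 = 0" "(3 * Suc i + 1) mod 3 = 1" "(3 * Suc i + 2) mod 3 = 2"
        by presburger+
      ultimately show ?thesis
        unfolding that(2) using that(1) by (subst (1 2 3) far) auto
    qed
    then have "(\<Sum>r<3 * Suc m. (\<Sum>j<3. ?T j (r mod 3) * ?W j (if r < 3 then Suc k else k)) * ?H $$ (r, q)) =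
       (\<Sum>j<3. ?T j 0 * ?W j (Suc k)) * oriented_K3 $$ (0, q) + (\<Sum>j<3. ?T j 1 * ?W j (Suc k)) * oriented_K3 $$ (1, q)
       + (\<Sum>j<3. ?T j 2 * ?W j (Suc k)) * oriented_K3 $$ (2, q) + of_nat m * S"
      unfolding sum_lessThan_3_mult_Suc using True by (simp add: K3_star_index)
    also have "\<dots> = (\<Sum>j<3. ((\<omega> ^ j) ^ (u + 2 * 0) * oriented_K3 $$ (0, q) + (\<omega> ^ j) ^ (u + 2 * 1) * oriented_K3 $$ (1, q)
      + (\<omega> ^ j) ^ (u + 2 * 2) * oriented_K3 $$ (2, q)) / 3 * ?W j (Suc k) + of_nat m * (?T j q * ?W j k))"
      by (simp add: S_def sum_distrib_left sum_distrib_right sum.distrib add_divide_distrib distrib_left distrib_right mult_ac)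
    also have "\<dots> = (\<Sum>j<3. ?T j q * ?W j (Suc (Suc k)))"
      using True by (intro sum.cong refl, subst oriented_K3_left_eigenvector)
        (simp_all add: walk_coeff_rec algebra_simps)
    finally show ?thesis using True by simp
  next
    case False
    \<comment> \<open>The leaf \<open>q\<close> has the single neighbour
      \<open>q mod 3\<close>.\<close>
    have "(\<Sum>r<3 * Suc m. (\<Sum>j<3. ?T j (r mod 3) * ?W j (if r < 3 then Suc k else k)) * ?H $$ (r, q)) =
       (\<Sum>r<3 * Suc m. if r = q mod 3 then (\<Sum>j<3. ?T j (q mod 3) * ?W j (Suc k)) else 0)"
      using False Suc.prems by (intro sum.cong refl) (auto simp: K3_star_index)
    also have "\<dots> = (\<Sum>j<3. ?T j (q mod 3) * ?W j (Suc k))"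
      by (subst sum.delta) auto
    finally show ?thesis using False by simp
  qed
  finally show ?case .
qed

section \<open>Summing the exponential series\<close>

lemma pow_mat_smult:
  fixes A :: "'a :: comm_semiring_1 mat"
  assumes "A \<in> carrier_mat n n"
  shows "(c \<cdot>\<^sub>m A) ^\<^sub>m k = c ^ k \<cdot>\<^sub>m (A ^\<^sub>m k)"
proof (induction k)
  case 0
  then show ?case using assms by (intro eq_matI) auto
next
  case (Suc k)
  have "A ^\<^sub>m k \<in> carrier_mat n n" using assms by simp
  then show ?case
    using Suc assms by (auto simp: mult_smult_assoc_mat mult_smult_distrib mult_ac intro: eq_matI)
qed

lemma walk_coeff_exp_sums:
  fixes c :: complex
  assumes "D = sqrt (l\<^sup>2 + 4 * real m)"
  shows "(\<lambda>k. c ^ k * walk_coeff m l (Suc k) / fact k) sums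
    ((complex_of_real ((l + D) / 2) * exp (c * complex_of_real ((l + D) / 2))
      - complex_of_real ((l - D) / 2) * exp (c * complex_of_real ((l - D) / 2))) / D)"
proof -
  have "(\<lambda>k. x * ((c * x) ^ k /\<^sub>R fact k)) sums (x * exp (c * x))" for x
    by (intro sums_mult exp_converges)
  from sums_divide[OF sums_diff[OF this[of "complex_of_real ((l + D) / 2)"] this[of "complex_of_real ((l - D) / 2)"]], of D]
  have "(\<lambda>k. (complex_of_real ((l + D) / 2) * ((c * complex_of_real ((l + D) / 2)) ^ k /\<^sub>R fact k)
      - complex_of_real ((l - D) / 2) * ((c * complex_of_real ((l - D) / 2)) ^ k /\<^sub>R fact k)) / D) sums
    ((complex_of_real ((l + D) / 2) * exp (c * complex_of_real ((l + D) / 2))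
      - complex_of_real ((l - D) / 2) * exp (c * complex_of_real ((l - D) / 2))) / D)" .
  moreover have "c ^ k * walk_coeff m l (Suc k) / fact k = (complex_of_real ((l + D) / 2) * ((c * complex_of_real ((l + D) / 2)) ^ k /\<^sub>R fact k)
      - complex_of_real ((l - D) / 2) * ((c * complex_of_real ((l - D) / 2)) ^ k /\<^sub>R fact k)) / D" for k
  proof -
    define x y where "x = complex_of_real ((l + D) / 2)" and "y = complex_of_real ((l - D) / 2)"
    have w: "complex_of_real (walk_coeff m l (Suc k)) = (x ^ Suc k - y ^ Suc k) / D"
      by (simp add: walk_coeff_def Let_def assms x_def y_def)
    show ?thesis
      unfolding x_def[symmetric] y_def[symmetric] w
      by (simp add: scaleR_conv_of_real field_simps power_mult_distrib)
  qed
  ultimately show ?thesis by presburger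
qed

text \<open>With \<open>z = D * t / 2\<close>, the common phase \<open>cis (- (l * t / 2))\<close>
  splits off from both exponentials, and what is left over \<open>D\<close> is
  \<open>D cos z - i l sin z\<close>.\<close>

lemma walk_coeff_exp_sums_cis:
  assumes "m > 0" and D: "D = sqrt (l\<^sup>2 + 4 * real m)"
  shows "(\<lambda>k. (- \<i> * complex_of_real t) ^ k * walk_coeff m l (Suc k) / fact k) sums
    (cis (- (l * t / 2)) * Complex (cos (D * t / 2)) (- (l / D * sin (D * t / 2))))"
proof -
  have D0: "D > 0"
    using assms by (simp add: add_nonneg_pos)
  have e: "exp (- \<i> * complex_of_real t * complex_of_real ((l + s * D) / 2)) = cis (- (l * t / 2)) * cis (- (s * (D * t / 2)))" for s
    unfolding cis_mult unfolding cis_conv_exp by (intro arg_cong[where f = exp]) (simp add: algebra_simps add_divide_distrib)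
  have e1: "exp (- \<i> * complex_of_real t * complex_of_real ((l + D) / 2)) = cis (- (l * t / 2)) * cis (- (D * t / 2))"
    and e2: "exp (- \<i> * complex_of_real t * complex_of_real ((l - D) / 2)) = cis (- (l * t / 2)) * cis (D * t / 2)"
    using e[of 1] e[of "-1"] by simp_all
  define z where "z = D * t / 2"
  define b where "b = cis (- (l * t / 2))"
  have "(complex_of_real ((l + D) / 2) * (b * cis (- z)) - complex_of_real ((l - D) / 2) * (b * cis z)) / D =
      b * ((complex_of_real ((l + D) / 2) * cis (- z) - complex_of_real ((l - D) / 2) * cis z) / D)"
    by (simp add: algebra_simps diff_divide_distrib add_divide_distrib)
  also have "(complex_of_real ((l + D) / 2) * cis (- z) - complex_of_real ((l - D) / 2) * cis z) / D = Complex (cos z) (- (l / D * sin z))"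
    using D0 by (simp add: complex_eq_iff field_simps)
  finally show ?thesis
    using walk_coeff_exp_sums[OF D, of "- \<i> * complex_of_real t"]
    unfolding e1 e2 z_def b_def by simp
qed

text \<open>
  The angle is a multiple of \<open>u + 2 * v\<close>, which is congruent to \<open>u - v\<close> modulo \<open>3\<close> and avoids the
  truncated subtraction.
\<close>

lemma transition_K3_star:
  assumes m: "m > 0" and u: "u < 3" and v: "v < 3" and D: "D = sqrt (4 * real m + 3)"
  defines "\<phi> \<equiv> 2 * pi * (u + 2 * v) / 3 :: real"
  shows "transition (K3_star m) t $$ (u, v) = complex_of_real ((cos (sqrt m * t)
    + 2 * (cos (\<phi> - sqrt 3 * t / 2) * cos (D * t / 2)
      + sqrt 3 / D * (sin (\<phi> - sqrt 3 * t / 2) * sin (D * t / 2)))) / 3)"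
proof -
  let ?c = "- \<i> * complex_of_real t"
  let ?H = "K3_star m"
  \<comment> \<open>The contribution of the \<open>j\<close>-th Fourier component to the
    exponential.\<close>
  define g where "g j = (let l = K3_eig j; D = sqrt (l\<^sup>2 + 4 * real m) in
    cis (- (l * t / 2)) * Complex (cos (D * t / 2)) (- (l / D * sin (D * t / 2))))" for j
  have "(\<lambda>k. \<Sum>j<3. (\<omega> ^ j) ^ (u + 2 * v) / 3 * (?c ^ k * walk_coeff m (K3_eig j) (Suc k) / fact k))
      sums (\<Sum>j<3. (\<omega> ^ j) ^ (u + 2 * v) / 3 * g j)"
    unfolding g_def Let_def by (intro sums_sum sums_mult walk_coeff_exp_sums_cis[OF m refl])
  moreover have "(\<Sum>j<3. (\<omega> ^ j) ^ (u + 2 * v) / 3 * (?c ^ k * walk_coeff m (K3_eig j) (Suc k) / fact k))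
      = ((?c \<cdot>\<^sub>m ?H) ^\<^sub>m k) $$ (u, v) / fact k" for k
  proof -
    have uv: "u < 3 * Suc m" "v < 3 * Suc m" using u v by auto
    have "((?c \<cdot>\<^sub>m ?H) ^\<^sub>m k) $$ (u, v) = ?c ^ k * (?H ^\<^sub>m k) $$ (u, v)"
      unfolding pow_mat_smult[OF K3_star_carrier] using uv K3_star_carrier[of m] by simp
    also have "(?H ^\<^sub>m k) $$ (u, v) = (\<Sum>j<3. (\<omega> ^ j) ^ (u + 2 * v) / 3 * walk_coeff m (K3_eig j) (Suc k))"
      using K3_star_pow_entry[OF m u uv(2), of k] v by simp
    finally show ?thesis
      by (simp add: sum_distrib_left sum_divide_distrib mult_ac)
  qed
  ultimately have "(\<lambda>k. ((?c \<cdot>\<^sub>m ?H) ^\<^sub>m k) $$ (u, v) / fact k) sums (\<Sum>j<3. (\<omega> ^ j) ^ (u + 2 * v) / 3 * g j)"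
    by simp
  then have "transition ?H t $$ (u, v) = (\<Sum>j<3. (\<omega> ^ j) ^ (u + 2 * v) / 3 * g j)"
    unfolding transition_def mat_exp_def using u v K3_star_carrier[of m]
    by (simp add: sums_iff)
  also have "\<dots> = (g 0 + cis \<phi> * g 1 + cis (- \<phi>) * g 2) / 3"
  proof -
    have 1: "\<omega> ^ (u + 2 * v) = cis \<phi>"
      unfolding \<omega>_def Complex.DeMoivre \<phi>_def by (simp add: field_simps)
    have "cis \<phi> ^ 3 = 1"
      unfolding 1[symmetric] by (metis \<omega>_cube mult.commute power_mult power_one)
    then have "(cis \<phi>)\<^sup>2 * cis \<phi> * cis (- \<phi>) = cis (- \<phi>)"
      by (simp add: eval_nat_numeral mult.assoc)
    \<comment> \<open>As \<open>cis \<phi>\<close> is a cube root of unity, the components 1 and 2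
      carry conjugate coefficients.\<close>
    then have 2: "(cis \<phi>)\<^sup>2 = cis (- \<phi>)"
      by (simp add: mult.assoc cis_mult)
    have 3: "(\<omega>\<^sup>2) ^ (u + 2 * v) = cis (- \<phi>)"
      unfolding 2[symmetric] 1[symmetric] by (simp add: mult.commute flip: power_mult)
    have "(\<Sum>j<3. (\<omega> ^ j) ^ (u + 2 * v) / 3 * g j) =
        (g 0 + \<omega> ^ (u + 2 * v) * g 1 + (\<omega>\<^sup>2) ^ (u + 2 * v) * g 2) / 3"
      by (simp add: numeral_3_eq_3 add_divide_distrib numeral_2_eq_2)
    then show ?thesis unfolding 1 3 .
  qed
  also have "g 0 + cis \<phi> * g 1 + cis (- \<phi>) * g 2 =
    complex_of_real (cos (sqrt m * t) + 2 * (cos (\<phi> - sqrt 3 * t / 2) * cos (D * t / 2)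
      + sqrt 3 / D * (sin (\<phi> - sqrt 3 * t / 2) * sin (D * t / 2))))"
  proof -
    have D': "sqrt (3 + 4 * real m) = D" by (simp add: D add.commute)
    \<comment> \<open>For the eigenvalue 0 the discriminant root is \<open>2 * sqrt m\<close> and
      the sine term vanishes.\<close>
    have g0: "g 0 = cos (sqrt m * t)"
      by (simp add: g_def Let_def K3_eig_def real_sqrt_mult complex_eq_iff)
    \<comment> \<open>With this angle the two remaining terms are complex conjugates, so their sum
      is real.\<close>
    define a where "a = \<phi> - sqrt 3 * t / 2"
    have g1: "cis \<phi> * g 1 = cis a * Complex (cos (D * t / 2)) (- (sqrt 3 / D * sin (D * t / 2)))"
      using D' by (simp add: g_def Let_def K3_eig_def cis_mult mult.assoc[symmetric] a_def)
    have g2: "cis (- \<phi>) * g 2 = cis (- a) * Complex (cos (D * t / 2)) (sqrt 3 / D * sin (D * t / 2))"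
      using D' by (simp add: g_def Let_def K3_eig_def cis_mult mult.assoc[symmetric] a_def)
    show ?thesis
      unfolding g0 g1 g2 a_def[symmetric] by (simp add: complex_eq_iff algebra_simps)
  qed
  finally show ?thesis by simp
qed

section \<open>Simultaneous approximation\<close>

text \<open>Kronecker's theorem with independence of the set of values over the integers replaced by
  a condition on coefficient vectors; the latter also gives injectivity, through the relation with
  coefficients 1 and -1.\<close>

lemma Kronecker_approx_int_independent:
  fixes \<alpha> \<theta> :: "nat \<Rightarrow> real" and n :: nat
  assumes indep: "\<And>c :: nat \<Rightarrow> int. (\<Sum>i<n. real_of_int (c i) * \<theta> i) = 0 \<Longrightarrow> \<forall>i<n. c i = 0"
    and "\<epsilon> > 0"
  shows "\<exists>t h. \<forall>i<n. \<bar>t * \<theta> i - real_of_int (h i) - \<alpha> i\<bar> < \<epsilon>"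
proof -
  interpret Modules.module "\<lambda>r. (*) (real_of_int r)"
    by (simp add: Modules.module.intro distrib_left mult.commute)
  have inj: "inj_on \<theta> {..<n}"
  proof (rule inj_onI, rule ccontr)
    fix i j assume ij: "i \<in> {..<n}" "j \<in> {..<n}" "\<theta> i = \<theta> j" "i \<noteq> j"
    define c where "c k = (if k = i then 1 else 0) - (if k = j then 1 else 0 :: int)" for k
    have "(\<Sum>k<n. c k * \<theta> k) = (\<Sum>k<n. (if k = i then \<theta> k else 0) - (if k = j then \<theta> k else 0))"
      by (intro sum.cong) (auto simp: c_def)
    also have "\<dots> = 0"
      using ij by (simp add: sum_subtractf)
    finally show False
      using indep[of c] ij by (auto simp: c_def)
  qed
  have "independent (\<theta> ` {..<n})"
  proof -
    have "u v = 0" if "(\<Sum>v\<in>\<theta> ` {..<n}. real_of_int (u v) * v) = 0" "v \<in> \<theta> ` {..<n}" for u v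
      using that indep[of "u \<circ> \<theta>"] by (auto simp: sum.reindex[OF inj])
    then show ?thesis
      by (subst dependent_finite) auto
  qed
  from Kronecker_thm_1[OF this inj \<open>\<epsilon> > 0\<close>, of \<alpha>] show ?thesis by metis
qed

section \<open>Integer relations between square roots\<close>

lemma is_square_if_square_mult_eq_square:
  fixes a b :: int
  assumes "a\<^sup>2 * int x = b\<^sup>2" "a \<noteq> 0"
  shows "is_square x"
proof -
  have "a\<^sup>2 dvd b\<^sup>2" using assms(1) by (metis dvd_triv_left)
  then obtain c where "b = a * c" by (auto simp: pow_divides_pow_iff)
  with assms have "int x = c\<^sup>2" by (simp add: power_mult_distrib)
  then have "x = (nat \<bar>c\<bar>)\<^sup>2"
    by (metis nat_int nat_power_eq abs_ge_zero power2_abs)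
  then show ?thesis ..
qed

text \<open>Squaring the relation and multiplying by \<open>y\<close> would exhibit
  \<open>a\<^sup>2 * (x * y)\<close> as a square.\<close>

lemma sqrt_int_independent_2:
  fixes x y :: nat and a b :: int
  assumes xy: "\<not> is_square (x * y)" and rel: "a * sqrt x + b * sqrt y = 0"
  shows "a = 0 \<and> b = 0"
proof -
  have "(a * sqrt x)\<^sup>2 = (b * sqrt y)\<^sup>2"
    using rel by (metis add_eq_0_iff power2_minus)
  then have "real_of_int (a\<^sup>2 * int x) = real_of_int (b\<^sup>2 * int y)"
    by (simp add: power_mult_distrib)
  then have "a\<^sup>2 * int x = b\<^sup>2 * int y"
    unfolding of_int_eq_iff .
  then have "a\<^sup>2 * int (x * y) = (b * int y)\<^sup>2"
    by (simp add: power2_eq_square)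
  with xy have "a = 0"
    using is_square_if_square_mult_eq_square by blast
  moreover have "y \<noteq> 0"
    using xy by (intro notI) simp
  ultimately show ?thesis
    using rel by simp
qed

text \<open>If \<open>b\<close> and \<open>c\<close> are nonzero, squaring
  \<open>b * sqrt y + c * sqrt z = - a * sqrt x\<close> makes the square root of
  \<open>y * z\<close> rational. Every other case reduces to two square roots.\<close>

lemma sqrt_int_independent_3:
  fixes x y z :: nat and a b c :: int
  assumes xy: "\<not> is_square (x * y)" and yz: "\<not> is_square (y * z)" and xz: "\<not> is_square (x * z)"
    and rel: "a * sqrt x + b * sqrt y + c * sqrt z = 0"
  shows "a = 0 \<and> b = 0 \<and> c = 0"
proof -
  have "a = 0"
  proof (cases "b = 0 \<or> c = 0")
    case True
    then show ?thesis
      using rel sqrt_int_independent_2[OF xz, of a c] sqrt_int_independent_2[OF xy, of a b] by auto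
  next
    case False
    have "(b * sqrt y + c * sqrt z)\<^sup>2 = (a * sqrt x)\<^sup>2"
      using rel by (metis add.assoc add_eq_0_iff power2_minus)
    then have "2 * b * c * (sqrt y * sqrt z) = real_of_int (a\<^sup>2 * int x - b\<^sup>2 * int y - c\<^sup>2 * int z)"
      by (simp add: power2_sum power_mult_distrib algebra_simps)
    then have "(2 * b * c * (sqrt y * sqrt z))\<^sup>2 = (real_of_int (a\<^sup>2 * int x - b\<^sup>2 * int y - c\<^sup>2 * int z))\<^sup>2"
      by simp
    then have "real_of_int ((2 * b * c)\<^sup>2 * int (y * z)) = real_of_int ((a\<^sup>2 * int x - b\<^sup>2 * int y - c\<^sup>2 * int z)\<^sup>2)"
      by (simp add: power_mult_distrib)
    then have "(2 * b * c)\<^sup>2 * int (y * z) = (a\<^sup>2 * int x - b\<^sup>2 * int y - c\<^sup>2 * int z)\<^sup>2"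
      unfolding of_int_eq_iff .
    with False yz is_square_if_square_mult_eq_square[of "2 * b * c" "y * z"] show ?thesis
      by auto
  qed
  then show ?thesis
    using rel sqrt_int_independent_2[OF yz, of b c] by simp
qed

lemma sqrt_approx_2:
  fixes x y :: nat
  assumes "\<not> is_square (x * y)" "\<epsilon> > 0"
  obtains t p q where "\<bar>t * sqrt x - of_int p - \<alpha>\<bar> < \<epsilon>" "\<bar>t * sqrt y - of_int q - \<beta>\<bar> < \<epsilon>"
proof -
  define \<theta> where "\<theta> = (\<lambda>i :: nat. if i = 0 then sqrt x else sqrt y)"
  define a where "a = (\<lambda>i :: nat. if i = 0 then \<alpha> else \<beta>)"
  have indep: "\<forall>i<2. c i = 0" if "(\<Sum>i<2. real_of_int (c i) * \<theta> i) = 0" for c :: "nat \<Rightarrow> int"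
    using that sqrt_int_independent_2[OF assms(1), of "c 0" "c 1"]
    by (simp add: \<theta>_def numeral_2_eq_2 less_Suc_eq)
  obtain t h where th: "\<forall>i<2. \<bar>t * \<theta> i - real_of_int (h i) - a i\<bar> < \<epsilon>"
    using Kronecker_approx_int_independent[OF indep assms(2), where \<alpha> = a] by blast
  show thesis
    using that[of t "h 0" "h 1"] spec[OF th, of 0] spec[OF th, of 1] by (simp add: \<theta>_def a_def)
qed

lemma sqrt_approx_3:
  fixes x y z :: nat
  assumes "\<not> is_square (x * y)" "\<not> is_square (y * z)" "\<not> is_square (x * z)" "\<epsilon> > 0"
  obtains t p q r where "\<bar>t * sqrt x - of_int p - \<alpha>\<bar> < \<epsilon>" "\<bar>t * sqrt y - of_int q - \<beta>\<bar> < \<epsilon>"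
    "\<bar>t * sqrt z - of_int r - \<gamma>\<bar> < \<epsilon>"
proof -
  define \<theta> where "\<theta> = (\<lambda>i :: nat. if i = 0 then sqrt x else if i = Suc 0 then sqrt y else sqrt z)"
  define a where "a = (\<lambda>i :: nat. if i = 0 then \<alpha> else if i = Suc 0 then \<beta> else \<gamma>)"
  have indep: "\<forall>i<3. c i = 0" if "(\<Sum>i<3. real_of_int (c i) * \<theta> i) = 0" for c :: "nat \<Rightarrow> int"
    using that sqrt_int_independent_3[OF assms(1-3), of "c 0" "c 1" "c 2"]
    by (simp add: \<theta>_def numeral_2_eq_2 numeral_3_eq_3 less_Suc_eq)
  obtain t h where th: "\<forall>i<3. \<bar>t * \<theta> i - real_of_int (h i) - a i\<bar> < \<epsilon>"
    using Kronecker_approx_int_independent[OF indep assms(4), where \<alpha> = a] by blast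
  show thesis
    using that[of t "h 0" "h 1" "h 2"] spec[OF th, of 0] spec[OF th, of 1] spec[OF th, of 2] by (simp add: \<theta>_def a_def)
qed

text \<open>
  The times \<open>4\<pi>t\<close> make the three angles of \<open>transition_K3_star\<close> close to \<open>4\<pi>p\<close>, \<open>2\<pi>q\<close> and
  \<open>- 2\<pi>r\<close>, so no signs need to be matched.
\<close>

definition approximable :: "nat \<Rightarrow> bool" where
  "approximable m \<longleftrightarrow> (\<forall>n::nat. \<forall>\<epsilon>>0. \<exists>t. \<exists>(p :: int) (q :: int) r :: int. \<bar>t * sqrt m - p\<bar> < \<epsilon> \<and>
    \<bar>t * sqrt (4 * real m + 3) - q\<bar> < \<epsilon> \<and> \<bar>t * sqrt 3 - r - n / 3\<bar> < \<epsilon>)"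

section \<open>Arithmetic conditions that make \<open>m\<close> approximable\<close>

lemma approximable_independent:
  assumes "\<not> is_square (m * (4 * m + 3))" "\<not> is_square ((4 * m + 3) * 3)" "\<not> is_square (m * 3)"
  shows "approximable m"
  unfolding approximable_def
proof (intro allI impI)
  fix n :: nat and \<epsilon> :: real assume "\<epsilon> > 0"
  from sqrt_approx_3[OF assms this, of 0 0 "n / 3"]
  obtain t p q r where "\<bar>t * sqrt m - real_of_int p - 0\<bar> < \<epsilon>" "\<bar>t * sqrt (real (4 * m + 3)) - real_of_int q - 0\<bar> < \<epsilon>"
    "\<bar>t * sqrt (real 3) - real_of_int r - n / 3\<bar> < \<epsilon>" by metis
  then show "\<exists>t. \<exists>(p :: int) (q :: int) r :: int. \<bar>t * sqrt m - p\<bar> < \<epsilon> \<and>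
    \<bar>t * sqrt (4 * real m + 3) - q\<bar> < \<epsilon> \<and> \<bar>t * sqrt 3 - r - n / 3\<bar> < \<epsilon>"
    by (intro exI[of _ t] exI[of _ p] exI[of _ q] exI[of _ r]) simp
qed

text \<open>If \<open>t * sqrt 3\<close> is close to \<open>r + n / 3\<close>, then its multiple by
  \<open>3 * c\<close> is close to the integer \<open>3 * c * r + c * n\<close>. The factor 3
  removes the fractional part, so only two numbers need to be approximated independently.\<close>

lemma sqrt_approx_3_dependent:
  fixes x c n :: nat
  assumes "\<not> is_square (x * 3)" "\<epsilon> > 0"
  obtains t and p q r :: int where "\<bar>t * sqrt x - p\<bar> < \<epsilon>" "\<bar>t * (3 * c * sqrt 3) - q\<bar> < \<epsilon>"
    "\<bar>t * sqrt 3 - r - n / 3\<bar> < \<epsilon>"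
proof -
  \<comment> \<open>The error grows by the factor \<open>3 * c\<close>; the summand 1 keeps the
    denominator positive for \<open>c = 0\<close>.\<close>
  define \<delta> where "\<delta> = \<epsilon> / (3 * c + 1)"
  have \<delta>: "\<delta> > 0" "\<delta> \<le> \<epsilon>" "3 * c * \<delta> < \<epsilon>"
    using assms(2) by (simp_all add: \<delta>_def field_simps)
  from sqrt_approx_2[OF assms(1) \<delta>(1), of 0 "n / 3"]
  obtain t p r where tpr: "\<bar>t * sqrt x - real_of_int p - 0\<bar> < \<delta>" "\<bar>t * sqrt (real 3) - real_of_int r - n / 3\<bar> < \<delta>"
    by metis
  have "t * (3 * c * sqrt 3) - (3 * int c * r + int c * int n) = 3 * c * (t * sqrt (real 3) - real_of_int r - n / 3)"
    by (simp add: algebra_simps)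
  then have "\<bar>t * (3 * c * sqrt 3) - (3 * int c * r + int c * int n)\<bar> = 3 * c * \<bar>t * sqrt (real 3) - real_of_int r - n / 3\<bar>"
    by (simp only: abs_mult)
  also have "\<dots> \<le> 3 * c * \<delta>"
    using tpr(2) by (intro mult_left_mono) auto
  finally show thesis
    using that[of t p "3 * int c * r + int c * int n" r] tpr \<delta> by auto
qed

text \<open>Here \<open>sqrt m = 3 * c * sqrt 3\<close> is the dependent number.\<close>

lemma approximable_if_eq_27_square:
  assumes "m = 27 * c\<^sup>2" "\<not> is_square ((4 * m + 3) * 3)"
  shows "approximable m"
  unfolding approximable_def
proof (intro allI impI)
  fix n :: nat and \<epsilon> :: real assume "\<epsilon> > 0"
  have "real m = (3 * real c)\<^sup>2 * 3"
    using assms(1) by (simp add: power_mult_distrib)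
  then have "sqrt m = sqrt ((3 * real c)\<^sup>2) * sqrt 3"
    by (simp only: real_sqrt_mult)
  then have m: "sqrt m = 3 * c * sqrt 3"
    unfolding real_sqrt_abs by simp
  from sqrt_approx_3_dependent[OF assms(2) \<open>\<epsilon> > 0\<close>, of c n]
  obtain t and p q r :: int where "\<bar>t * sqrt (real (4 * m + 3)) - p\<bar> < \<epsilon>" "\<bar>t * (3 * c * sqrt 3) - q\<bar> < \<epsilon>"
    "\<bar>t * sqrt 3 - r - n / 3\<bar> < \<epsilon>" by metis
  then show "\<exists>t. \<exists>(p :: int) (q :: int) r :: int. \<bar>t * sqrt m - p\<bar> < \<epsilon> \<and>
    \<bar>t * sqrt (4 * real m + 3) - q\<bar> < \<epsilon> \<and> \<bar>t * sqrt 3 - r - n / 3\<bar> < \<epsilon>"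
    unfolding m by (intro exI[of _ t] exI[of _ q] exI[of _ p] exI[of _ r]) simp
qed

text \<open>Here \<open>sqrt (4 * m + 3) = 3 * c * sqrt 3\<close> is the dependent number.\<close>

lemma approximable_if_4_mult_add_3_eq:
  assumes "4 * m + 3 = 27 * c\<^sup>2" "\<not> is_square (m * 3)"
  shows "approximable m"
  unfolding approximable_def
proof (intro allI impI)
  fix n :: nat and \<epsilon> :: real assume "\<epsilon> > 0"
  have "4 * real m + 3 = real (27 * c\<^sup>2)"
    unfolding assms(1)[symmetric] by simp
  then have "4 * real m + 3 = (3 * real c)\<^sup>2 * 3"
    by (simp add: power_mult_distrib)
  then have "sqrt (4 * real m + 3) = sqrt ((3 * real c)\<^sup>2) * sqrt 3"
    by (simp only: real_sqrt_mult)
  then have D: "sqrt (4 * real m + 3) = 3 * c * sqrt 3"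
    unfolding real_sqrt_abs by simp
  from sqrt_approx_3_dependent[OF assms(2) \<open>\<epsilon> > 0\<close>, of c n]
  show "\<exists>t. \<exists>(p :: int) (q :: int) r :: int. \<bar>t * sqrt m - p\<bar> < \<epsilon> \<and>
    \<bar>t * sqrt (4 * real m + 3) - q\<bar> < \<epsilon> \<and> \<bar>t * sqrt 3 - r - n / 3\<bar> < \<epsilon>"
    unfolding D by metis
qed

text \<open>Neither \<open>m\<close> nor \<open>4 * m + 3\<close> is divisible by 3, so three times
  either one contains 3 exactly once. Both are coprime, so a square product would make
  \<open>4 * m + 3\<close> a square, which is impossible modulo 4.\<close>

lemma approximable_if_not_dvd:
  assumes "\<not> 3 dvd m"
  shows "approximable m"
proof (rule approximable_independent)
  have sq3: "\<not> is_square (k * 3)" if "\<not> 3 dvd k" for k :: nat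
  proof
    assume "is_square (k * 3)"
    then obtain y where y: "k * 3 = y\<^sup>2" by (elim is_nth_powerE)
    then have "3 dvd y\<^sup>2" by (metis dvd_triv_right)
    then have "3 dvd y" by (rule prime_dvd_power[rotated]) simp
    then obtain z where "y = 3 * z" ..
    with y have "k = 3 * z\<^sup>2" by (simp add: power_mult_distrib)
    with that show False by simp
  qed
  show "\<not> is_square (m * 3)" "\<not> is_square ((4 * m + 3) * 3)"
    using assms by (intro sq3; presburger)+
  show "\<not> is_square (m * (4 * m + 3))"
  proof
    assume sq: "is_square (m * (4 * m + 3))"
    have "coprime m (4 * m + 3)"
    proof -
      have "coprime 3 m"
        using assms by (intro prime_imp_coprime) simp_all
      then show ?thesis
        using gcd_add_mult[of m 4 3] by (simp add: coprime_iff_gcd_eq_1 gcd.commute)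
    qed
    then have "is_square (4 * m + 3)"
      using sq assms by (intro is_nth_power_mult_coprime_natD(2)[OF _ sq]) (auto intro: Nat.gr0I)
    then obtain y where y: "4 * m + 3 = y\<^sup>2" by (elim is_nth_powerE)
    have "(4 * m + 3) mod 4 = 3" by presburger
    then have "(y mod 4) * (y mod 4) mod 4 = 3"
      unfolding y power2_eq_square by (simp add: mod_mult_eq)
    moreover have "y mod 4 = 0 \<or> y mod 4 = 1 \<or> y mod 4 = 2 \<or> y mod 4 = 3" by presburger
    ultimately show False by auto
  qed
qed

lemma is_square_9_mult: "is_square (9 * k) \<longleftrightarrow> is_square k" for k :: nat
using is_nth_power_mult_cancel_left[OF is_nth_power_nth_power[of 2 "3 :: nat"], of k] by simp

text \<open>All three products are 9 times one of \<open>s\<close>, \<open>4 * s + 1\<close> and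
  \<open>s * (4 * s + 1)\<close>, and the two factors of the last are coprime.\<close>

lemma approximable_mult_3:
  assumes "s > 0" "\<not> is_square s" "\<not> is_square (4 * s + 1)"
  shows "approximable (3 * s)"
proof (rule approximable_independent)
  have "gcd s (4 * s + 1) = 1"
    using gcd_add_mult[of s 4 1] by simp
  then have coprime: "\<not> is_square (s * (4 * s + 1))"
    using assms is_nth_power_mult_coprime_nat_iff by (metis coprime_iff_gcd_eq_1)
  have eqs: "3 * s * (4 * (3 * s) + 3) = 9 * (s * (4 * s + 1))" "(4 * (3 * s) + 3) * 3 = 9 * (4 * s + 1)"
    "3 * s * 3 = 9 * s"
    by (simp_all add: algebra_simps)
  show "\<not> is_square (3 * s * (4 * (3 * s) + 3))" "\<not> is_square ((4 * (3 * s) + 3) * 3)"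
    "\<not> is_square (3 * s * 3)"
    unfolding eqs is_square_9_mult by (rule coprime assms)+
qed

text \<open>The number lies strictly between consecutive squares. This prevents
  \<open>sqrt m\<close> and \<open>sqrt (4 * m + 3)\<close> from both being rational multiples of
  \<open>sqrt 3\<close>.\<close>

lemma square_add_1_not_square:
  fixes x :: nat
  assumes "x > 0"
  shows "\<not> is_square (x\<^sup>2 + 1)"
proof
  assume "is_square (x\<^sup>2 + 1)"
  then obtain y where y: "x\<^sup>2 + 1 = y\<^sup>2" by (elim is_nth_powerE)
  then have "x < y" by (metis less_add_one power_less_imp_less_base zero_le)
  then have "(x + 1)\<^sup>2 \<le> y\<^sup>2" by (intro power_mono) auto
  with y assms show False by (simp add: power2_eq_square)
qed

section \<open>Trigonometric estimates\<close>

lemma abs_sin_nat_mult_le: "\<bar>sin (real N * x)\<bar> \<le> N * \<bar>sin x\<bar>"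
proof (induction N)
  case (Suc N)
  have "sin (real (Suc N) * x) = sin (N * x) * cos x + cos (N * x) * sin x"
    by (simp add: distrib_right sin_add add.commute)
  also have "\<bar>\<dots>\<bar> \<le> \<bar>sin (N * x)\<bar> * \<bar>cos x\<bar> + \<bar>cos (N * x)\<bar> * \<bar>sin x\<bar>"
    by (metis abs_mult abs_triangle_ineq)
  also have "\<dots> \<le> \<bar>sin (N * x)\<bar> * 1 + 1 * \<bar>sin x\<bar>"
    by (intro add_mono mult_left_mono mult_right_mono) auto
  finally show ?case using Suc by (simp add: algebra_simps)
qed simp

text \<open>Follows from \<open>N * x = N * y + N * (x - y)\<close>. Measuring the distance of
  \<open>x\<close> and \<open>y\<close> by a sine makes the estimate insensitive to multiples of
  \<pi>.\<close>

lemma abs_sin_mult_le_near: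
  "\<bar>sin (real N * x)\<bar> \<le> \<bar>sin (N * y)\<bar> + N * \<bar>sin (x - y)\<bar>"
proof -
  have "sin (N * x) = sin (N * y + N * (x - y))"
    by (simp add: algebra_simps)
  also have "\<bar>\<dots>\<bar> \<le> \<bar>sin (N * y)\<bar> * \<bar>cos (N * (x - y))\<bar> + \<bar>cos (N * y)\<bar> * \<bar>sin (N * (x - y))\<bar>"
    unfolding sin_add by (metis abs_mult abs_triangle_ineq)
  also have "\<dots> \<le> \<bar>sin (N * y)\<bar> * 1 + 1 * \<bar>sin (N * (x - y))\<bar>"
    by (intro add_mono mult_left_mono mult_right_mono) auto
  also have "\<dots> \<le> \<bar>sin (N * y)\<bar> + N * \<bar>sin (x - y)\<bar>"
    using abs_sin_nat_mult_le[of N "x - y"] by simp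
  finally show ?thesis .
qed

lemma dvd_3_if_sin_eq_0:
  assumes "sin (real N * (4 * pi / 3)) = 0"
  shows "3 dvd N"
proof -
  obtain i :: int where "real N * (4 * pi / 3) = i * pi"
    using assms by (auto simp: sin_zero_iff_int2)
  then have "real_of_int (4 * int N) = real_of_int (3 * i)"
    by (simp add: field_simps)
  then have "4 * int N = 3 * i" unfolding of_int_eq_iff .
  then show ?thesis by presburger
qed

text \<open>\<open>Q\<close> is an inner product of \<open>(cos a, sin a)\<close> and \<open>(cos z, \<kappa> sin z)\<close>, so Cauchy--Schwarz applies.\<close>

lemma sin_square_le_of_twisted_cos:
  fixes \<kappa> a z :: real
  defines "Q \<equiv> cos a * cos z + \<kappa> * (sin a * sin z)"
  assumes "\<kappa>\<^sup>2 \<le> 1"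
  shows "(1 - \<kappa>\<^sup>2) * (sin z)\<^sup>2 \<le> 1 - Q\<^sup>2"
proof -
  have "1 - Q\<^sup>2 - (1 - \<kappa>\<^sup>2) * (sin z)\<^sup>2 = (cos z)\<^sup>2 + \<kappa>\<^sup>2 * (sin z)\<^sup>2 - Q\<^sup>2"
    by (simp add: cos_squared_eq algebra_simps)
  also have "\<dots> = ((sin a)\<^sup>2 + (cos a)\<^sup>2) * ((cos z)\<^sup>2 + \<kappa>\<^sup>2 * (sin z)\<^sup>2) - Q\<^sup>2"
    by simp
  \<comment> \<open>Lagrange's identity: the Cauchy--Schwarz defect is the square of a
    determinant.\<close>
  also have "\<dots> = (\<kappa> * (cos a * sin z) - sin a * cos z)\<^sup>2"
  proof -
    have "(S\<^sup>2 + C\<^sup>2) * (c\<^sup>2 + \<kappa>\<^sup>2 * s\<^sup>2) - (C * c + \<kappa> * (S * s))\<^sup>2 = (\<kappa> * (C * s) - S * c)\<^sup>2"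
      for S C c s :: real by (simp add: power2_eq_square algebra_simps)
    then show ?thesis unfolding Q_def by blast
  qed
  also have "\<dots> \<ge> 0" by simp
  finally show ?thesis by simp
qed

text \<open>Each cosine is at least \<open>1 - \<delta>\<close> and the twisted term at least
  \<open>- \<delta>\<close>, for a total loss of \<open>7 * \<delta> / 3\<close>, rounded up to
  \<open>3 * \<delta>\<close>.\<close>

lemma twisted_cos_ge:
  fixes \<kappa> \<delta> x y z :: real
  assumes "\<bar>x\<bar> \<le> \<delta>" "\<bar>y\<bar> \<le> \<delta>" "\<bar>z\<bar> \<le> \<delta>" "\<delta> \<le> 1" "0 \<le> \<kappa>" "\<kappa> \<le> 1"
  shows "(cos x + 2 * (cos y * cos z + \<kappa> * (sin y * sin z))) / 3 \<ge> 1 - 3 * \<delta>"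
proof -
  have c: "cos w \<ge> 1 - \<delta>" if "\<bar>w\<bar> \<le> \<delta>" for w
  proof -
    have "(sin (w / 2))\<^sup>2 \<le> \<bar>sin (w / 2)\<bar>"
      using mult_left_mono[of "\<bar>sin (w / 2)\<bar>" 1 "\<bar>sin (w / 2)\<bar>"] by (simp add: power2_eq_square)
    also have "\<bar>sin (w / 2)\<bar> \<le> \<bar>w / 2\<bar>" by (rule abs_sin_x_le_abs_x)
    finally show ?thesis
      using that cos_double_sin[of "w / 2"] by simp
  qed
  have s: "\<bar>sin w\<bar> \<le> \<delta>" if "\<bar>w\<bar> \<le> \<delta>" for w
    using that abs_sin_x_le_abs_x[of w] by linarith
  have "(1 - \<delta>) * (1 - \<delta>) \<le> cos y * cos z"
    using assms c[of y] c[of z] by (intro mult_mono) auto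
  moreover have "\<bar>\<kappa> * (sin y * sin z)\<bar> \<le> 1 * (\<delta> * 1)"
    unfolding abs_mult using assms s[of y] by (intro mult_mono) auto
  moreover have "(1 - \<delta>) * (1 - \<delta>) \<ge> 1 - 2 * \<delta>"
    by (simp add: algebra_simps)
  ultimately show ?thesis
    using c[OF assms(1)] assms(1) by (simp add: abs_le_iff)
qed

section \<open>State transfer\<close>

lemma pgst_if_approximable:
  assumes m: "m > 0" and uv: "u < 3" "v < 3" and app: "approximable m"
  shows "pgst (K3_star m) u v"
  unfolding pgst_def
proof (intro allI impI)
  fix \<epsilon> :: real assume "\<epsilon> > 0"
  define \<delta> where "\<delta> = min 1 (\<epsilon> / 3)"
  define n where "n = u + 2 * v"
  define D where "D = sqrt (4 * real m + 3)"
  have \<delta>: "\<delta> > 0" "\<delta> \<le> 1" "3 * \<delta> \<le> \<epsilon>"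
    using \<open>\<epsilon> > 0\<close> by (auto simp: \<delta>_def)
  have "\<delta> / (4 * pi) > 0" using \<delta> by simp
  with app[unfolded approximable_def] obtain t and p q r :: int where
    tpqr: "\<bar>t * sqrt m - p\<bar> < \<delta> / (4 * pi)" "\<bar>t * D - q\<bar> < \<delta> / (4 * pi)" "\<bar>t * sqrt 3 - r - n / 3\<bar> < \<delta> / (4 * pi)"
    unfolding D_def by blast
  define \<tau> where "\<tau> = 4 * pi * t"
  define \<phi> where "\<phi> = 2 * pi * n / 3"
  \<comment> \<open>What is left of the three angles at time \<tau> after removing whole
    turns.\<close>
  define x y z where "x = 4 * pi * (t * sqrt m - p)" and "y = 2 * pi * (n / 3 + r - t * sqrt 3)"
    and "z = 2 * pi * (t * D - q)"
  \<comment> \<open>The prefactors of \<open>x\<close>, \<open>y\<close>, \<open>z\<close> are at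
    most \<open>4 * pi\<close> in absolute value, whence the tolerance
    \<open>\<delta> / (4 * pi)\<close>.\<close>
  have scale: "\<bar>k * w\<bar> \<le> \<delta>" if "\<bar>w\<bar> < \<delta> / (4 * pi)" "0 \<le> k" "k \<le> 4 * pi" for k w
  proof -
    have "\<bar>k * w\<bar> = k * \<bar>w\<bar>" using that by (simp add: abs_mult)
    also have "\<dots> \<le> (4 * pi) * (\<delta> / (4 * pi))"
      using that by (intro mult_mono) auto
    finally show ?thesis by simp
  qed
  have "\<bar>x\<bar> \<le> \<delta>" "\<bar>y\<bar> \<le> \<delta>" "\<bar>z\<bar> \<le> \<delta>"
    unfolding x_def y_def z_def using tpqr by (intro scale; (simp | linarith))+
  have "cos (sqrt m * \<tau>) = cos (x + 2 * pi * of_int (2 * p))"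
    by (simp add: x_def \<tau>_def algebra_simps)
  then have cx: "cos (sqrt m * \<tau>) = cos x"
    by (simp only: cos_add cos_int_2pin sin_int_2pin mult_1_right mult_zero_right diff_zero)
  have "\<phi> - sqrt 3 * \<tau> / 2 = y + 2 * pi * of_int (- r)" "D * \<tau> / 2 = z + 2 * pi * of_int q"
    by (simp_all add: y_def z_def \<tau>_def \<phi>_def algebra_simps)
  then have cyz: "cos (\<phi> - sqrt 3 * \<tau> / 2) = cos y" "sin (\<phi> - sqrt 3 * \<tau> / 2) = sin y"
    "cos (D * \<tau> / 2) = cos z" "sin (D * \<tau> / 2) = sin z"
    by (simp_all only: cos_add sin_add cos_int_2pin sin_int_2pin mult_1_right mult_zero_right diff_zero add_0_right)
  have D: "sqrt 3 \<le> D" "D > 0"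
    by (simp_all add: D_def)
  define R where "R = (cos x + 2 * (cos y * cos z + sqrt 3 / D * (sin y * sin z))) / 3"
  have "transition (K3_star m) \<tau> $$ (u, v) = complex_of_real R"
    using transition_K3_star[OF m uv D_def, of \<tau>] cyz
    unfolding R_def cx[symmetric] cyz[symmetric] \<phi>_def n_def by simp
  moreover have "R \<ge> 1 - 3 * \<delta>"
    unfolding R_def using D \<open>\<bar>x\<bar> \<le> \<delta>\<close> \<open>\<bar>y\<bar> \<le> \<delta>\<close> \<open>\<bar>z\<bar> \<le> \<delta>\<close> \<delta> by (intro twisted_cos_ge) auto
  ultimately have "cmod (transition (K3_star m) \<tau> $$ (u, v)) \<ge> 1 - \<epsilon>"
    using \<delta> by (simp add: abs_if)
  then show "\<exists>\<tau>. 1 - \<epsilon> \<le> cmod (transition (K3_star m) \<tau> $$ (u, v))" ..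
qed

text \<open>If \<open>\<bar>P\<bar>\<close> and \<open>\<bar>Q\<bar>\<close> are at most 1 and
  \<open>\<bar>P + 2 * Q\<bar>\<close> is close to 3, both are close to 1. The first bounds the sine
  of \<open>sqrt m * t\<close>, the second, by \<open>sin_square_le_of_twisted_cos\<close>, the
  other two sines. The angle \<open>4 * pi / 3\<close> is that of \<open>u = 0\<close>,
  \<open>v = 1\<close>.\<close>

lemma small_sines_if_pgst:
  assumes m: "m > 0" and pgst: "pgst (K3_star m) 0 1" and "\<delta> > 0"
  shows "\<exists>t. \<bar>sin (sqrt m * t)\<bar> < \<delta> \<and> \<bar>sin (sqrt (4 * real m + 3) * t / 2)\<bar> < \<delta> \<and>
    \<bar>sin (4 * pi / 3 - sqrt 3 * t / 2)\<bar> < \<delta>"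
proof -
  define D where "D = sqrt (4 * real m + 3)"
  define \<kappa> where "\<kappa> = sqrt 3 / D"
  define c where "c = 1 - \<kappa>\<^sup>2"
  have \<kappa>2: "\<kappa>\<^sup>2 = 3 / (4 * real m + 3)"
    by (simp add: \<kappa>_def D_def power_divide)
  then have "\<kappa>\<^sup>2 < 1"
    using m by simp
  then have c: "0 < c" "c \<le> 1" "\<kappa>\<^sup>2 \<le> 1"
    using m by (simp_all add: c_def)
  \<comment> \<open>The argument loses a factor 6, so 7 makes the final inequality strict.\<close>
  define \<epsilon> where "\<epsilon> = c * \<delta>\<^sup>2 / 7"
  have \<epsilon>: "\<epsilon> > 0" using c \<open>\<delta> > 0\<close> by (simp add: \<epsilon>_def)
  then obtain t where t: "cmod (transition (K3_star m) t $$ (0, 1)) \<ge> 1 - \<epsilon>"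
    using pgst by (auto simp: pgst_def)
  define a z P Q where "a = 4 * pi / 3 - sqrt 3 * t / 2" and "z = D * t / 2" and "P = cos (sqrt m * t)"
    and "Q = cos a * cos z + \<kappa> * (sin a * sin z)"
  have "transition (K3_star m) t $$ (0, 1) = complex_of_real ((P + 2 * Q) / 3)"
    using transition_K3_star[OF m _ _ D_def, of 0 1 t]
    by (simp add: P_def Q_def a_def z_def \<kappa>_def)
  then have PQ: "\<bar>P + 2 * Q\<bar> \<ge> 3 - 3 * \<epsilon>"
    using t by (simp add: norm_divide del: of_real_add of_real_mult of_real_divide)
  have z: "c * (sin z)\<^sup>2 \<le> 1 - Q\<^sup>2"
    using sin_square_le_of_twisted_cos[OF c(3), of z a] by (simp add: c_def Q_def)
  \<comment> \<open>\<open>Q\<close> is symmetric in the two angles.\<close>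
  have a: "c * (sin a)\<^sup>2 \<le> 1 - Q\<^sup>2"
    using sin_square_le_of_twisted_cos[OF c(3), of a z] by (simp add: c_def Q_def mult.commute)
  have "0 \<le> c * (sin z)\<^sup>2" using c by simp
  then have "Q\<^sup>2 \<le> 1" using z by linarith
  then have Q: "\<bar>Q\<bar> \<le> 1" by (simp add: abs_square_le_1)
  have P: "\<bar>P\<bar> \<le> 1" by (simp add: P_def)
  have sq: "1 - x\<^sup>2 \<le> 6 * \<epsilon>" if "\<bar>x\<bar> \<le> 1" "\<bar>x\<bar> \<ge> 1 - 3 * \<epsilon>" for x :: real
  proof -
    have "1 - x\<^sup>2 = (1 - \<bar>x\<bar>) * (1 + \<bar>x\<bar>)"
      by (simp add: power2_eq_square algebra_simps)
    also have "\<dots> \<le> (3 * \<epsilon>) * 2"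
      using that \<epsilon> by (intro mult_mono) auto
    finally show ?thesis by simp
  qed
  have "\<bar>P\<bar> \<ge> 1 - 3 * \<epsilon>" "\<bar>Q\<bar> \<ge> 1 - 3 * \<epsilon>"
    using PQ P Q \<epsilon> by linarith+
  then have PQ6: "1 - P\<^sup>2 \<le> 6 * \<epsilon>" "1 - Q\<^sup>2 \<le> 6 * \<epsilon>"
    using P Q sq by blast+
  have small: "\<bar>s\<bar> < \<delta>" if "c * s\<^sup>2 \<le> 6 * \<epsilon>" for s
  proof -
    have "7 * (c * s\<^sup>2) < 7 * (c * \<delta>\<^sup>2)"
      using that \<epsilon> by (simp add: \<epsilon>_def)
    then have "\<bar>s\<bar>\<^sup>2 < \<delta>\<^sup>2" using c by simp
    then show ?thesis by (rule power2_less_imp_less) (rule less_imp_le[OF \<open>\<delta> > 0\<close>])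
  qed
  have "c * (sin (sqrt m * t))\<^sup>2 \<le> 1 * (sin (sqrt m * t))\<^sup>2"
    using c by (intro mult_right_mono) auto
  also have "\<dots> = 1 - P\<^sup>2"
    by (simp add: P_def sin_squared_eq)
  finally have "c * (sin (sqrt m * t))\<^sup>2 \<le> 1 - P\<^sup>2" .
  then show ?thesis
    using small[of "sin (sqrt m * t)"] small[of "sin z"] small[of "sin a"] z a PQ6
    unfolding z_def a_def D_def by (intro exI[of _ t]) linarith
qed

text \<open>By \<open>abs_sin_mult_le_near\<close> the sine of \<open>N * (4 * pi / 3)\<close> is
  bounded by \<open>(N + 1) * \<delta>\<close> for every \<open>\<delta> > 0\<close>, so it
  vanishes. The proof takes \<delta> to be its absolute value over \<open>N + 1\<close>.\<close>

lemma dvd_3_if_small_sines: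
  fixes N :: nat
  assumes "\<And>\<delta>. \<delta> > 0 \<Longrightarrow> \<exists>t. \<bar>sin (N * (sqrt 3 * t / 2))\<bar> < \<delta> \<and> \<bar>sin (4 * pi / 3 - sqrt 3 * t / 2)\<bar> < \<delta>"
  shows "3 dvd N"
proof (rule dvd_3_if_sin_eq_0, rule ccontr)
  let ?s = "sin (real N * (4 * pi / 3))"
  assume "?s \<noteq> 0"
  then have "\<bar>?s\<bar> / (N + 1) > 0" by simp
  from assms[OF this] obtain t where t: "\<bar>sin (N * (sqrt 3 * t / 2))\<bar> < \<bar>?s\<bar> / (N + 1)"
    "\<bar>sin (4 * pi / 3 - sqrt 3 * t / 2)\<bar> < \<bar>?s\<bar> / (N + 1)" by blast
  have "\<bar>?s\<bar> \<le> \<bar>sin (N * (sqrt 3 * t / 2))\<bar> + N * \<bar>sin (4 * pi / 3 - sqrt 3 * t / 2)\<bar>"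
    by (rule abs_sin_mult_le_near)
  also have "\<dots> < \<bar>?s\<bar> / (N + 1) + N * (\<bar>?s\<bar> / (N + 1))"
    using t by (intro add_less_le_mono mult_left_mono) auto
  also have "\<dots> = (real N + 1) * (\<bar>?s\<bar> / (real N + 1))"
    by (simp only: distrib_right mult_1 of_nat_add of_nat_1 add.commute)
  also have "\<dots> = \<bar>?s\<bar>"
    by (rule nonzero_mult_div_cancel_left[THEN trans[OF times_divide_eq_right]]) simp
  finally show False by simp
qed

text \<open>Here \<open>sqrt m * t\<close> is the multiple \<open>2 * n\<close> of
  \<open>sqrt 3 * t / 2\<close>, and 2 is coprime to 3.\<close>

lemma dvd_3_if_pgst_mult_3_square:
  assumes "n > 0" "pgst (K3_star (3 * n\<^sup>2)) 0 1"
  shows "3 dvd n"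
proof -
  have sqrt: "sqrt (3 * n\<^sup>2) = sqrt 3 * n"
    by (simp add: real_sqrt_mult)
  have "3 dvd 2 * n"
  proof (rule dvd_3_if_small_sines)
    fix \<delta> :: real assume "\<delta> > 0"
    with small_sines_if_pgst[OF _ assms(2) this] assms(1)
    obtain t where t: "\<bar>sin (sqrt (3 * n\<^sup>2) * t)\<bar> < \<delta>" "\<bar>sin (4 * pi / 3 - sqrt 3 * t / 2)\<bar> < \<delta>"
      by auto
    have "sqrt (3 * n\<^sup>2) * t = real (2 * n) * (sqrt 3 * t / 2)"
      unfolding sqrt by simp
    then show "\<exists>t. \<bar>sin (real (2 * n) * (sqrt 3 * t / 2))\<bar> < \<delta> \<and> \<bar>sin (4 * pi / 3 - sqrt 3 * t / 2)\<bar> < \<delta>"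
      using t by metis
  qed
  then show ?thesis by presburger
qed

text \<open>Here half of \<open>sqrt (4 * m + 3) * t\<close>, with \<open>m = 3 * s\<close>, is the
  multiple \<open>n\<close> of \<open>sqrt 3 * t / 2\<close>.\<close>

lemma dvd_3_if_pgst_4_mult_add_1_square:
  assumes "s > 0" "4 * s + 1 = n\<^sup>2" "pgst (K3_star (3 * s)) 0 1"
  shows "3 dvd n"
proof (rule dvd_3_if_small_sines)
  have "4 * real (3 * s) + 3 = real (3 * (4 * s + 1))" by simp
  also have "sqrt \<dots> = sqrt 3 * n"
    unfolding assms(2) by (simp add: real_sqrt_mult)
  finally have sqrt: "sqrt (4 * real (3 * s) + 3) = sqrt 3 * n" .
  fix \<delta> :: real assume "\<delta> > 0"
  with small_sines_if_pgst[OF _ assms(3) this] assms(1)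
  obtain t where t: "\<bar>sin (sqrt (4 * real (3 * s) + 3) * t / 2)\<bar> < \<delta>" "\<bar>sin (4 * pi / 3 - sqrt 3 * t / 2)\<bar> < \<delta>"
    by (metis mult_pos_pos zero_less_numeral)
  have "sqrt (4 * real (3 * s) + 3) * t / 2 = real n * (sqrt 3 * t / 2)"
    unfolding sqrt by simp
  then show "\<exists>t. \<bar>sin (real n * (sqrt 3 * t / 2))\<bar> < \<delta> \<and> \<bar>sin (4 * pi / 3 - sqrt 3 * t / 2)\<bar> < \<delta>"
    using t by metis
qed

text \<open>Bridges the integer squares of the theorem and the natural-number squares of the
  preceding lemmas.\<close>

lemma is_square_int_iff: "is_square (int k) \<longleftrightarrow> is_square k"
proof
  assume "is_square (int k)"
  then obtain y where "int k = y\<^sup>2" by (elim is_nth_powerE)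
  then have "k = (nat \<bar>y\<bar>)\<^sup>2"
    by (metis nat_int nat_power_eq abs_ge_zero power2_abs)
  then show "is_square k" ..
next
  assume "is_square k"
  then obtain y where "k = y\<^sup>2" by (elim is_nth_powerE)
  then have "int k = (int y)\<^sup>2" by simp
  then show "is_square (int k)" ..
qed

theorem theorem5p4:
  fixes m :: nat
  assumes "m > 0"
  shows "multiple_pgst (rooted_product oriented_K3 (star m)) {0, 1, 2} \<longleftrightarrow>
    gcd 3 m = 1 \<or>
    (\<exists>s::int. int m = 3 * s \<and> \<not> is_square s \<and> \<not> is_square (4 * s + 1)) \<or>
    (\<exists>k::int. int m = 27 * k\<^sup>2) \<or>
    (\<exists>k::int. int m = 27 * k\<^sup>2 + 27 * k + 6)"
    (is "?pgst \<longleftrightarrow> ?A \<or> ?B \<or> ?C \<or> ?D")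
proof
  assume "?pgst"
  \<comment> \<open>Transfer between this one pair already forces the arithmetic conditions.\<close>
  then have pgst: "pgst (K3_star m) 0 1"
    by (auto simp: multiple_pgst_def)
  show "?A \<or> ?B \<or> ?C \<or> ?D"
  proof (cases "3 dvd m")
    case False
    then have "coprime 3 m" by (intro prime_imp_coprime) simp_all
    then show ?thesis by simp
  next
    case True
    then obtain s where s: "m = 3 * s" ..
    with assms have "s > 0" by simp
    consider "\<not> is_square s" "\<not> is_square (4 * s + 1)" | "is_square s" | "is_square (4 * s + 1)"
      by blast
    then show ?thesis
    proof cases
      case 1
      have "4 * int s + 1 = int (4 * s + 1)" by simp
      then have "\<not> is_square (int s)" "\<not> is_square (4 * int s + 1)"
        using 1 is_square_int_iff by metis+
      then have ?B using s by (intro exI[of _ "int s"]) simp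
      then show ?thesis by simp
    next
      case 2
      then obtain n where n: "s = n\<^sup>2" by (elim is_nth_powerE)
      have "n > 0" using n \<open>s > 0\<close> by (intro Nat.gr0I) simp
      then have "3 dvd n"
        using dvd_3_if_pgst_mult_3_square pgst unfolding s n by blast
      then obtain k where "n = 3 * k" ..
      then have "int m = 27 * (int k)\<^sup>2" using s n by (simp add: power_mult_distrib)
      then show ?thesis by blast
    next
      case 3
      then obtain n where n: "4 * s + 1 = n\<^sup>2" by (elim is_nth_powerE)
      then have "3 dvd n"
        using dvd_3_if_pgst_4_mult_add_1_square[OF \<open>s > 0\<close> n] pgst s by blast
      \<comment> \<open>Parity turns \<open>n = 3 * j\<close> into
        \<open>n = 3 * (2 * k + 1)\<close>, which produces the quadratic polynomial in
        \<open>k\<close>.\<close>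
      moreover have "odd n"
      proof -
        have "odd (4 * s + 1)" by simp
        then show ?thesis unfolding n by simp
      qed
      ultimately obtain k where "n = 3 * (2 * k + 1)"
        by (metis dvd_def even_mult_iff oddE)
      with n have "4 * s + 1 = (3 * (2 * k + 1))\<^sup>2" by simp
      then have "m = 27 * k\<^sup>2 + 27 * k + 6"
        unfolding s by (simp add: power2_eq_square algebra_simps)
      then have "int m = 27 * (int k)\<^sup>2 + 27 * int k + 6" by simp
      then show ?thesis by blast
    qed
  qed
next
  assume "?A \<or> ?B \<or> ?C \<or> ?D"
  then have "approximable m"
  proof (elim disjE exE conjE)
    assume "gcd 3 m = 1"
    then have "\<not> 3 dvd m" by (auto simp: gcd_proj1_if_dvd)
    then show ?thesis by (rule approximable_if_not_dvd)
  next
    fix s :: int assume s: "int m = 3 * s" "\<not> is_square s" "\<not> is_square (4 * s + 1)"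
    define s' where "s' = nat s"
    have s': "s = int s'" "4 * s + 1 = int (4 * s' + 1)" "m = 3 * s'" "s' > 0"
      using s(1) assms by (simp_all add: s'_def)
    then show ?thesis
      using s approximable_mult_3[of s'] is_square_int_iff by metis
  next
    fix k :: int assume k: "int m = 27 * k\<^sup>2"
    define c where "c = nat \<bar>k\<bar>"
    have "int m = int (27 * c\<^sup>2)"
      using k by (simp add: c_def)
    then have m: "m = 27 * c\<^sup>2" unfolding of_nat_eq_iff .
    have eq: "(4 * m + 3) * 3 = 9 * ((6 * c)\<^sup>2 + 1)"
      unfolding m by (simp add: power_mult_distrib)
    have "c > 0" using m assms by (intro Nat.gr0I) simp
    then have "\<not> is_square ((4 * m + 3) * 3)"
      unfolding eq is_square_9_mult by (intro square_add_1_not_square) simp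
    with m show ?thesis by (rule approximable_if_eq_27_square)
  next
    fix k :: int assume k: "int m = 27 * k\<^sup>2 + 27 * k + 6"
    \<comment> \<open>Completing the square:
      \<open>4 * m + 3 = 27 * (2 * k + 1)\<^sup>2\<close>.\<close>
    define c where "c = nat \<bar>2 * k + 1\<bar>"
    have "int (4 * m + 3) = int (27 * c\<^sup>2)"
      using k by (simp add: c_def power2_eq_square algebra_simps)
    then have m: "4 * m + 3 = 27 * c\<^sup>2" unfolding of_nat_eq_iff .
    have "\<not> is_square (m * 3)"
    proof
      assume "is_square (m * 3)"
      moreover have "m mod 3 = 0" using k by presburger
      then have "m * 3 = 9 * (m div 3)" by presburger
      ultimately have "is_square (m div 3)" using is_square_9_mult by metis
      then obtain y where y: "m div 3 = y\<^sup>2" by (elim is_nth_powerE)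
      with \<open>m mod 3 = 0\<close> have m3: "m = 3 * y\<^sup>2" by presburger
      then have "y > 0" using assms by (intro Nat.gr0I) simp
      \<comment> \<open>Substituting \<open>m = 3 * y\<^sup>2\<close> into
        \<open>4 * m + 3 = 27 * c\<^sup>2\<close> and dividing by 3.\<close>
      have "(2 * y)\<^sup>2 + 1 = (3 * c)\<^sup>2"
        using m unfolding m3 by (simp add: power_mult_distrib)
      then have "is_square ((2 * y)\<^sup>2 + 1)"
        using is_nth_power_nth_power by metis
      moreover have "2 * y > 0" using \<open>y > 0\<close> by simp
      ultimately show False
        using square_add_1_not_square by blast
    qed
    with m show ?thesis by (rule approximable_if_4_mult_add_3_eq)
  qed
  then show ?pgst
    unfolding multiple_pgst_def
  proof (intro ballI impI)
    fix u v :: nat assume "u \<in> {0, 1, 2}" "v \<in> {0, 1, 2}"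
    then have "u < 3" "v < 3" by auto
    with assms \<open>approximable m\<close> show "pgst (K3_star m) u v"
      by (intro pgst_if_approximable)
  qed
qed

end
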